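(* Consider equilibria of the Sellers' Information Disclosure Game with two sellers (qualities $Q_1\ge Q_2\ge0$, marginal privacy costs $c_1,c_2$), one buyer with prior belief $Q_0$ and maximal estimation bias $\epsilon_0$. There are three key differences between the positive estimation bias case ($\epsilon_0>0$) and the no estimation bias case ($\epsilon_0=0$): (i) A seller $i$ whose quality is below average ($Q_i<Q_0$) never discloses information when $\epsilon_0=0$; but he may do so when $\epsilon_0>0$ (i.e., for some parameters there is an equilibrium at which he does). (ii) A seller who does not disclose information earns a zero profit when $\epsilon_0=0$; but he may obtain a positive (expected) profit when $\epsilon_0>0$. (iii) It is never possible for both sellers to receive positive expected profits when $\epsilon_0=0$; however, it is possible when $\epsilon_0>0$.
   Context: Model. Two sellers $i\in\{1,2\}$ compete for one buyer. Seller $i$ chooses a disclosure level $\alpha_i\in[0,1]$ and a price $p_i\in[0,\infty)$. The buyer has estimation bias $\epsilon\sim U(-\epsilon_0,\epsilon_0)$, unknown to the sellers, with $\epsilon_0\le Q_0/3$ ($\epsilon=0$ if $\epsilon_0=0$). Choosing seller $i$ gives her payoff $\alpha_iQ_i+(1-\alpha_i)(Q_0+\epsilon)-p_i$; she picks the seller with the larger payoff, ties being broken with probability $1/2$ each. With $Pr_i$ the resulting winning probability, seller $i$'s expected profit is $E_\epsilon[p_i\,Pr_i-c_i\alpha_i]$. Stage I-b (pricing): for given $(\alpha_1,\alpha_2)$ sellers simultaneously choose prices. With $\psi=\alpha_1(Q_1-Q_0)-\alpha_2(Q_2-Q_0)$ and $\xi=\epsilon_0|\alpha_1-\alpha_2|$: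 if $\alpha_1\ne\alpha_2$, equilibrium prices are $(0,-\psi-\xi)$ if $\psi\le-3\xi$, $\left(\frac{3\xi+\psi}{3},\frac{3\xi-\psi}{3}\right)$ if $-3\xi<\psi<3\xi$, $(\psi-\xi,0)$ if $\psi\ge3\xi$; if $\alpha_1=\alpha_2=0$ both prices are $0$; if $\alpha_1=\alpha_2>0$ there is taken to be no pure pricing equilibrium. In the benchmark $\epsilon_0=0$ the same formulas are used with $\xi=0$, the seller with the positive price winning the buyer (limit of undercutting). Stage I-a (Sellers' Information Disclosure Game): sellers simultaneously choose $\alpha_i\in[0,1]$, the payoff being the expected profit at the Stage I-b prices. An equilibrium is a profile $(\alpha_1^*,\alpha_2^* )$ at which no seller can increase this payoff by a unilateral change of $\alpha_i\in[0,1]$ (profiles with $\alpha_1=\alpha_2>0$ are not equilibria). Seller $i$ discloses information if $\alpha_i^*>0$.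
   Formalization: The marginal privacy costs c_1, c_2 are assumed strictly positive; with a zero cost the claim fails (e.g. ε_0=0, both qualities below Q_0, c_1=0: the profile (1,0) is an equilibrium where seller 1 discloses and seller 2 profits). *)

theory Defs
  imports "HOL-Probability.Probability"
begin

datatype seller = Seller1 | Seller2

fun other :: "seller \<Rightarrow> seller" where
  "other Seller1 = Seller2"
| "other Seller2 = Seller1"

text \<open>
  Throughout, \<open>Q\<close> are the qualities, \<open>c\<close> the marginal privacy costs, \<open>Q0\<close> the prior belief,
  \<open>e0\<close> the maximal estimation bias, \<open>\<alpha>\<close> the disclosure levels and \<open>p\<close> the prices.
  Privacy costs are strictly positive: a seller with zero cost would be indifferent between all
  disclosure levels whenever he cannot win the buyer.
\<close>

definition game_params ::
  "(seller \<Rightarrow> real) \<Rightarrow> (seller \<Rightarrow> real) \<Rightarrow> real \<Rightarrow> real \<Rightarrow> bool" where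
  "game_params Q c Q0 e0 \<longleftrightarrow>
     Q Seller1 \<ge> Q Seller2 \<and> Q Seller2 \<ge> 0 \<and> (\<forall>i. c i > 0) \<and> 0 \<le> e0 \<and> e0 \<le> Q0 / 3"

definition bias_distribution :: "real \<Rightarrow> real measure" where
  "bias_distribution e0 =
     (if e0 = 0 then return borel 0 else uniform_measure lborel {- e0<..<e0})"

definition buyer_payoff ::
  "(seller \<Rightarrow> real) \<Rightarrow> real \<Rightarrow> (seller \<Rightarrow> real) \<Rightarrow> (seller \<Rightarrow> real) \<Rightarrow> real \<Rightarrow> seller \<Rightarrow> real" where
  "buyer_payoff Q Q0 \<alpha> p \<epsilon> i = \<alpha> i * Q i + (1 - \<alpha> i) * (Q0 + \<epsilon>) - p i"

text \<open>
  Without bias, the prices below leave the buyer exactly indifferent, and the seller with the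
  positive price gets her, as the limit of undercutting by arbitrarily small amounts.
  All other ties are broken evenly.
\<close>

definition tie_prob :: "real \<Rightarrow> (seller \<Rightarrow> real) \<Rightarrow> seller \<Rightarrow> real" where
  "tie_prob e0 p i =
     (if e0 = 0 \<and> p i > 0 \<and> p (other i) = 0 then 1
      else if e0 = 0 \<and> p i = 0 \<and> p (other i) > 0 then 0
      else 1 / 2)"

definition win_prob ::
  "(seller \<Rightarrow> real) \<Rightarrow> real \<Rightarrow> real \<Rightarrow> (seller \<Rightarrow> real) \<Rightarrow> (seller \<Rightarrow> real) \<Rightarrow> real \<Rightarrow> seller \<Rightarrow> real" where
  "win_prob Q Q0 e0 \<alpha> p \<epsilon> i =
     (if buyer_payoff Q Q0 \<alpha> p \<epsilon> i > buyer_payoff Q Q0 \<alpha> p \<epsilon> (other i) then 1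
      else if buyer_payoff Q Q0 \<alpha> p \<epsilon> i < buyer_payoff Q Q0 \<alpha> p \<epsilon> (other i) then 0
      else tie_prob e0 p i)"

definition expected_profit ::
  "(seller \<Rightarrow> real) \<Rightarrow> (seller \<Rightarrow> real) \<Rightarrow> real \<Rightarrow> real \<Rightarrow> (seller \<Rightarrow> real) \<Rightarrow> (seller \<Rightarrow> real) \<Rightarrow> seller \<Rightarrow> real" where
  "expected_profit Q c Q0 e0 \<alpha> p i =
     (\<integral>\<epsilon>. p i * win_prob Q Q0 e0 \<alpha> p \<epsilon> i - c i * \<alpha> i \<partial>bias_distribution e0)"

text \<open>
  The prices of the pricing stage; \<open>None\<close> means that there is no pure pricing equilibrium.
\<close>

definition stage_prices ::
  "(seller \<Rightarrow> real) \<Rightarrow> real \<Rightarrow> real \<Rightarrow> (seller \<Rightarrow> real) \<Rightarrow> (seller \<Rightarrow> real) option" where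
  "stage_prices Q Q0 e0 \<alpha> =
     (let \<psi> = \<alpha> Seller1 * (Q Seller1 - Q0) - \<alpha> Seller2 * (Q Seller2 - Q0);
          \<xi> = e0 * \<bar>\<alpha> Seller1 - \<alpha> Seller2\<bar>
      in if \<alpha> Seller1 = \<alpha> Seller2 then (if \<alpha> Seller1 = 0 then Some (\<lambda>_. 0) else None)
         else if \<psi> \<le> - 3 * \<xi> then Some (case_seller 0 (- \<psi> - \<xi>))
         else if \<psi> < 3 * \<xi> then Some (case_seller ((3 * \<xi> + \<psi>) / 3) ((3 * \<xi> - \<psi>) / 3))
         else Some (case_seller (\<psi> - \<xi>) 0))"

definition disclosure_payoff ::
  "(seller \<Rightarrow> real) \<Rightarrow> (seller \<Rightarrow> real) \<Rightarrow> real \<Rightarrow> real \<Rightarrow> (seller \<Rightarrow> real) \<Rightarrow> seller \<Rightarrow> real option" where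
  "disclosure_payoff Q c Q0 e0 \<alpha> i =
     map_option (\<lambda>p. expected_profit Q c Q0 e0 \<alpha> p i) (stage_prices Q Q0 e0 \<alpha>)"

text \<open>
  A unilateral change to a profile without payoffs does not increase a seller's payoff; the payoffs
  at an equilibrium itself must exist.
\<close>

definition disclosure_equilibrium ::
  "(seller \<Rightarrow> real) \<Rightarrow> (seller \<Rightarrow> real) \<Rightarrow> real \<Rightarrow> real \<Rightarrow> (seller \<Rightarrow> real) \<Rightarrow> bool" where
  "disclosure_equilibrium Q c Q0 e0 \<alpha> \<longleftrightarrow>
     (\<forall>i. \<alpha> i \<in> {0..1}) \<and>
     (\<forall>i. \<exists>v. disclosure_payoff Q c Q0 e0 \<alpha> i = Some v \<and>
        (\<forall>a\<in>{0..1}. \<forall>w. disclosure_payoff Q c Q0 e0 (\<alpha>(i := a)) i = Some w \<longrightarrow> w \<le> v))"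

definition discloses :: "(seller \<Rightarrow> real) \<Rightarrow> seller \<Rightarrow> bool" where
  "discloses \<alpha> i \<longleftrightarrow> \<alpha> i > 0"

end

theory Submission
  imports Defs
begin

text \<open>
  Write \<open>A\<^sub>i\<close> for the quality advantage \<open>\<alpha>\<^sub>i(Q\<^sub>i - Q\<^sub>0) - \<alpha>\<^sub>j(Q\<^sub>j - Q\<^sub>0)\<close> of seller \<open>i\<close>. Without bias, his payoff
  is \<open>max A\<^sub>i 0 - c\<^sub>i\<alpha>\<^sub>i\<close>; if \<open>Q\<^sub>i < Q\<^sub>0\<close> this is strictly decreasing in \<open>\<alpha>\<^sub>i\<close>, so he does not disclose.
  Hence only above-average sellers disclose, against whom a seller with \<open>\<alpha>\<^sub>i = 0\<close> has \<open>A\<^sub>i \<le> 0\<close>.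
  As \<open>A\<^sub>1 = - A\<^sub>2\<close>, at most one payoff is positive.

  With bias, in the interior regime \<open>\<bar>A\<^sub>i\<bar> < 3\<xi>\<close> the payoff is \<open>(3\<xi> + A\<^sub>i)\<^sup>2/(18\<xi>) - c\<^sub>i\<alpha>\<^sub>i\<close>. If both
  qualities equal \<open>Q\<^sub>0 - r\<close> with \<open>0 < r < 3\<epsilon>\<^sub>0\<close>, then \<open>A\<^sub>i\<close> and \<open>\<xi>\<close> are multiples of \<open>\<alpha>\<^sub>i - \<alpha>\<^sub>j\<close> and of its absolute
  value, so all payoffs are linear in \<open>\<alpha>\<close>, and for small costs full disclosure by one seller and
  none by the other is an equilibrium at which both sellers profit.
\<close>

text \<open>For \<open>Seller1\<close> this is the \<psi> of the pricing stage, for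
  \<open>Seller2\<close> its negative; indexing by seller lets payoffs be computed once for a
  generic \<open>i\<close>.\<close>

definition advantage ::
  "(seller \<Rightarrow> real) \<Rightarrow> real \<Rightarrow> (seller \<Rightarrow> real) \<Rightarrow> seller \<Rightarrow> real" where
  "advantage Q Q0 \<alpha> i = \<alpha> i * (Q i - Q0) - \<alpha> (other i) * (Q (other i) - Q0)"

lemma other_other [simp]: "other (other i) = i"
  by (cases i) auto

lemma other_neq [simp]: "other i \<noteq> i" "i \<noteq> other i"
  by (cases i; simp)+

lemma all_seller_iff: "(\<forall>j. P j) \<longleftrightarrow> P i \<and> P (other i)"
  by (metis other.simps seller.exhaust)

lemma advantage_other: "advantage Q Q0 \<alpha> (other i) = - advantage Q Q0 \<alpha> i"
  by (simp add: advantage_def)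

text \<open>The comparison is affine in the bias with slope
  \<open>- (\<alpha> i - \<alpha> (other i))\<close>, so with unequal levels the biases at which a
  seller wins strictly form a half-line.\<close>

lemma buyer_payoff_diff:
  "buyer_payoff Q Q0 \<alpha> p \<epsilon> i - buyer_payoff Q Q0 \<alpha> p \<epsilon> (other i)
     = advantage Q Q0 \<alpha> i - (\<alpha> i - \<alpha> (other i)) * \<epsilon> - (p i - p (other i))"
  by (simp add: buyer_payoff_def advantage_def algebra_simps)

subsection \<open>No estimation bias\<close>

text \<open>With \<xi> = 0 the middle pricing regime is empty, and the two outer ones combine into
  positive parts of the advantages.\<close>

lemma stage_prices_no_bias:
  assumes "\<alpha> Seller1 \<noteq> \<alpha> Seller2 \<or> \<alpha> Seller1 = 0"
  shows "stage_prices Q Q0 0 \<alpha> = Some (\<lambda>i. max (advantage Q Q0 \<alpha> i) 0)"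
proof -
  have "stage_prices Q Q0 0 \<alpha> = Some (case_seller (max (advantage Q Q0 \<alpha> Seller1) 0)
      (max (advantage Q Q0 \<alpha> Seller2) 0))"
    using assms by (auto simp: stage_prices_def Let_def advantage_def fun_eq_iff split: seller.split)
  also have "case_seller (f Seller1) (f Seller2) = f" for f :: "seller \<Rightarrow> real"
    by (auto simp: fun_eq_iff split: seller.split)
  finally show ?thesis .
qed

text \<open>The prices differ by exactly the advantage, so the buyer is indifferent and
  \<open>tie_prob\<close> alone decides who wins.\<close>

lemma disclosure_payoff_no_bias:
  assumes "\<alpha> i \<noteq> \<alpha> (other i) \<or> \<alpha> i = 0"
  shows "disclosure_payoff Q c Q0 0 \<alpha> i = Some (max (advantage Q Q0 \<alpha> i) 0 - c i * \<alpha> i)"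
proof -
  define p where "p = (\<lambda>j. max (advantage Q Q0 \<alpha> j) 0)"
  have "\<alpha> Seller1 \<noteq> \<alpha> Seller2 \<or> \<alpha> Seller1 = 0"
    using assms by (cases i) auto
  then have prices: "stage_prices Q Q0 0 \<alpha> = Some p"
    unfolding p_def by (rule stage_prices_no_bias)
  have "buyer_payoff Q Q0 \<alpha> p 0 i - buyer_payoff Q Q0 \<alpha> p 0 (other i) = 0"
    unfolding buyer_payoff_diff by (simp add: p_def advantage_other)
  \<comment> \<open>If \<open>p i > 0\<close>, the rival's price is 0 and seller \<open>i\<close>
    wins the tie; if \<open>p i = 0\<close>, both sides vanish whatever the tie rule says.\<close>
  then have "p i * win_prob Q Q0 0 \<alpha> p 0 i = p i"
    by (auto simp: win_prob_def tie_prob_def p_def advantage_other max_def)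
  moreover have "(\<lambda>\<epsilon>. p i * win_prob Q Q0 0 \<alpha> p \<epsilon> i - c i * \<alpha> i) \<in> borel_measurable borel"
    unfolding win_prob_def buyer_payoff_def by measurable
  ultimately have "expected_profit Q c Q0 0 \<alpha> p i = p i - c i * \<alpha> i"
    by (simp add: expected_profit_def bias_distribution_def integral_return)
  then show ?thesis
    by (simp add: disclosure_payoff_def prices p_def)
qed

text \<open>An equilibrium must have payoffs, which excludes equal nonzero levels, the only profiles
  without prices.\<close>

lemma equilibrium_no_bias_payoff:
  assumes "disclosure_equilibrium Q c Q0 0 \<alpha>"
  shows "disclosure_payoff Q c Q0 0 \<alpha> i = Some (max (advantage Q Q0 \<alpha> i) 0 - c i * \<alpha> i)"
proof (rule disclosure_payoff_no_bias)
  obtain v where "disclosure_payoff Q c Q0 0 \<alpha> i = Some v"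
    using assms unfolding disclosure_equilibrium_def by blast
  then show "\<alpha> i \<noteq> \<alpha> (other i) \<or> \<alpha> i = 0"
    by (cases i) (auto simp: disclosure_payoff_def stage_prices_def Let_def split: if_splits)
qed

text \<open>Deviating to level 0 would remove a negative term from the advantage and save a positive
  cost, hence be strictly profitable.\<close>

lemma below_average_not_discloses_no_bias:
  assumes "c i > 0" and eq: "disclosure_equilibrium Q c Q0 0 \<alpha>" and "Q i < Q0"
  shows "\<not> discloses \<alpha> i"
proof
  assume "discloses \<alpha> i"
  then have pos: "\<alpha> i > 0"
    by (simp add: discloses_def)
  let ?\<beta> = "\<alpha>(i := 0)"
  have "disclosure_payoff Q c Q0 0 ?\<beta> i = Some (max (advantage Q Q0 ?\<beta> i) 0)"
    by (subst disclosure_payoff_no_bias) auto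
  then have "max (advantage Q Q0 ?\<beta> i) 0 \<le> max (advantage Q Q0 \<alpha> i) 0 - c i * \<alpha> i"
    using eq equilibrium_no_bias_payoff[OF eq, of i] unfolding disclosure_equilibrium_def
    by (metis atLeastAtMost_iff order_refl option.inject zero_le_one)
  moreover have "\<alpha> i * (Q i - Q0) < 0" "c i * \<alpha> i > 0"
    using pos assms by (auto simp: mult_pos_neg)
  ultimately show False
    by (simp add: advantage_def max_def split: if_splits)
qed

text \<open>A rival below average is silent too, and any other rival contributes
  \<open>\<alpha> (other i) * (Q (other i) - Q0) \<ge> 0\<close>; either way the silent seller has
  no positive advantage.\<close>

lemma nondisclosing_payoff_no_bias:
  assumes "\<forall>j. c j > 0" and eq: "disclosure_equilibrium Q c Q0 0 \<alpha>" and "\<not> discloses \<alpha> i"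
  shows "disclosure_payoff Q c Q0 0 \<alpha> i = Some 0"
proof -
  have nonneg: "\<alpha> j \<ge> 0" for j
    using eq by (auto simp: disclosure_equilibrium_def)
  then have zero: "\<alpha> i = 0"
    using assms(3) by (simp add: discloses_def order_antisym)
  have "\<alpha> (other i) * (Q (other i) - Q0) \<ge> 0"
  proof (cases "Q (other i) < Q0")
    case True
    then show ?thesis
      using below_average_not_discloses_no_bias[OF _ eq True] assms(1) nonneg[of "other i"]
      by (simp add: discloses_def)
  next
    case False
    then show ?thesis
      using nonneg by simp
  qed
  then show ?thesis
    by (simp add: equilibrium_no_bias_payoff[OF eq] zero advantage_def)
qed

text \<open>As costs are nonnegative, a positive payoff needs a positive advantage, but the two
  advantages are opposite numbers.\<close>

lemma not_both_positive_no_bias: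
  assumes "\<forall>j. c j > 0" and eq: "disclosure_equilibrium Q c Q0 0 \<alpha>"
  shows "\<not> (\<forall>i. \<exists>v. disclosure_payoff Q c Q0 0 \<alpha> i = Some v \<and> v > 0)"
proof
  assume "\<forall>i. \<exists>v. disclosure_payoff Q c Q0 0 \<alpha> i = Some v \<and> v > 0"
  then have *: "max (advantage Q Q0 \<alpha> i) 0 - c i * \<alpha> i > 0" for i
    by (simp add: equilibrium_no_bias_payoff[OF eq])
  have "c i * \<alpha> i \<ge> 0" for i
    using assms by (simp add: disclosure_equilibrium_def less_imp_le)
  then have "advantage Q Q0 \<alpha> i > 0" for i
    using *[of i] by (smt (verit, best))
  from this[of Seller1] this[of "other Seller1"] show False
    unfolding advantage_other by simp
qed

subsection \<open>Positive estimation bias\<close>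

lemma stage_prices_interior:
  assumes "\<alpha> Seller1 \<noteq> \<alpha> Seller2"
    and "\<bar>advantage Q Q0 \<alpha> Seller1\<bar> < 3 * (e0 * \<bar>\<alpha> Seller1 - \<alpha> Seller2\<bar>)"
  shows "stage_prices Q Q0 e0 \<alpha> =
    Some (\<lambda>i. (3 * (e0 * \<bar>\<alpha> Seller1 - \<alpha> Seller2\<bar>) + advantage Q Q0 \<alpha> i) / 3)"
  using assms
  by (auto simp: stage_prices_def Let_def advantage_def fun_eq_iff abs_less_iff split: seller.splits)

text \<open>The cut point \<open>t / d\<close> lies inside the interval. The half-line keeps the
  left piece if \<open>d > 0\<close> and the right piece if \<open>d < 0\<close>; in both cases its
  length is \<open>e + t / \<bar>d\<bar>\<close>.\<close>

lemma measure_uniform_interval_halfline: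
  fixes d e t :: real
  assumes "e > 0" "d \<noteq> 0" "\<bar>t\<bar> < e * \<bar>d\<bar>"
  shows "measure (uniform_measure lborel {- e<..<e}) {x. d * x < t} = (e * \<bar>d\<bar> + t) / (2 * (e * \<bar>d\<bar>))"
proof -
  have "measure (uniform_measure lborel {- e<..<e}) {x. d * x < t}
      = measure lborel ({- e<..<e} \<inter> {x. d * x < t}) / (2 * e)"
    using assms by (simp add: measure_uniform_measure)
  also have "measure lborel ({- e<..<e} \<inter> {x. d * x < t}) = e + t / \<bar>d\<bar>"
  proof (cases "d > 0")
    case True
    then have "- e < t / d" "t / d < e"
      using assms by (auto simp: field_simps abs_less_iff)
    moreover have "d * x < t \<longleftrightarrow> x < t / d" for x
      using True by (simp add: pos_less_divide_eq mult.commute)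
    ultimately have "{- e<..<e} \<inter> {x. d * x < t} = {- e<..<t / d}"
      unfolding set_eq_iff Int_iff greaterThanLessThan_iff mem_Collect_eq
      by (meson order.strict_trans)
    then show ?thesis
      using True \<open>- e < t / d\<close> by simp
  next
    case False
    then have "d < 0"
      using assms by simp
    then have "- e < t / d" "t / d < e"
      using assms by (auto simp: field_simps abs_less_iff)
    moreover have "d * x < t \<longleftrightarrow> t / d < x" for x
      using \<open>d < 0\<close> by (simp add: neg_divide_less_eq mult.commute)
    ultimately have "{- e<..<e} \<inter> {x. d * x < t} = {t / d<..<e}"
      unfolding set_eq_iff Int_iff greaterThanLessThan_iff mem_Collect_eq
      by (meson order.strict_trans)
    then show ?thesis
      using \<open>d < 0\<close> \<open>t / d < e\<close> by simp
  qed
  finally show ?thesis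
    using assms by (simp add: field_simps)
qed

text \<open>With advantage A, the price (3\<xi> + A)/3 is earned with probability (3\<xi> +
  A)/(6\<xi>).\<close>

lemma disclosure_payoff_interior:
  fixes \<alpha> :: "seller \<Rightarrow> real" and e0 :: real and i :: seller
  defines "\<xi> \<equiv> e0 * \<bar>\<alpha> i - \<alpha> (other i)\<bar>"
  assumes "e0 > 0" "\<alpha> i \<noteq> \<alpha> (other i)" "\<bar>advantage Q Q0 \<alpha> i\<bar> < 3 * \<xi>"
  shows "disclosure_payoff Q c Q0 e0 \<alpha> i =
    Some ((3 * \<xi> + advantage Q Q0 \<alpha> i)\<^sup>2 / (18 * \<xi>) - c i * \<alpha> i)"
proof -
  define p where "p = (\<lambda>j. (3 * \<xi> + advantage Q Q0 \<alpha> j) / 3)"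
  define d t where "d = \<alpha> i - \<alpha> (other i)" and "t = advantage Q Q0 \<alpha> i / 3"
  let ?M = "uniform_measure lborel {- e0<..<e0}"
  have \<xi>: "\<xi> = e0 * \<bar>\<alpha> Seller1 - \<alpha> Seller2\<bar>"
    by (cases i) (auto simp: \<xi>_def)
  have "\<alpha> Seller1 \<noteq> \<alpha> Seller2"
    using assms(3) by (cases i) auto
  moreover have "\<bar>advantage Q Q0 \<alpha> Seller1\<bar> < 3 * \<xi>"
    using assms(4) advantage_other[of Q Q0 \<alpha> Seller1] by (cases i) auto
  ultimately have prices: "stage_prices Q Q0 e0 \<alpha> = Some p"
    unfolding p_def \<xi> by (rule stage_prices_interior)
  have prob: "prob_space ?M"
    using assms(2) by (intro prob_space_uniform_measure) auto
  have d: "d \<noteq> 0" "\<xi> = e0 * \<bar>d\<bar>"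
    using assms(3) by (auto simp: d_def \<xi>_def)
  \<comment> \<open>The interior prices differ by two thirds of the advantage; the remaining third
    is \<open>t\<close>.\<close>
  have gap: "buyer_payoff Q Q0 \<alpha> p \<epsilon> i - buyer_payoff Q Q0 \<alpha> p \<epsilon> (other i) = t - d * \<epsilon>" for \<epsilon>
    unfolding buyer_payoff_diff by (simp add: p_def advantage_other d_def t_def field_simps)
  \<comment> \<open>A tie needs this single bias value, so the tie rule does not affect the
    integral.\<close>
  have "AE \<epsilon> in ?M. \<epsilon> \<noteq> t / d"
    using AE_lborel_singleton[of "t / d"] by (intro AE_uniform_measureI) auto
  then have win: "AE \<epsilon> in ?M. p i * win_prob Q Q0 e0 \<alpha> p \<epsilon> i - c i * \<alpha> i
      = p i * indicator {\<epsilon>. d * \<epsilon> < t} \<epsilon> - c i * \<alpha> i"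
  proof eventually_elim
    case (elim \<epsilon>)
    then have "d * \<epsilon> \<noteq> t"
      using d by auto
    then show ?case
      using gap[of \<epsilon>] by (auto simp: win_prob_def indicator_def)
  qed
  have "expected_profit Q c Q0 e0 \<alpha> p i
      = (\<integral>\<epsilon>. p i * indicator {\<epsilon>. d * \<epsilon> < t} \<epsilon> - c i * \<alpha> i \<partial>?M)"
  proof -
    have "(\<lambda>\<epsilon>. p i * win_prob Q Q0 e0 \<alpha> p \<epsilon> i - c i * \<alpha> i) \<in> borel_measurable ?M"
      unfolding win_prob_def buyer_payoff_def by measurable
    then show ?thesis
      using win assms(2) unfolding expected_profit_def bias_distribution_def
      by (auto intro!: integral_cong_AE)
  qed
  also have "\<dots> = p i * measure ?M {\<epsilon>. d * \<epsilon> < t} - c i * \<alpha> i"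
  proof -
    interpret prob_space ?M by (fact prob)
    have "integrable ?M (indicator {\<epsilon>. d * \<epsilon> < t} :: real \<Rightarrow> real)"
      by (simp add: emeasure_eq_measure)
    then show ?thesis
      using prob_space by simp
  qed
  also have "measure ?M {\<epsilon>. d * \<epsilon> < t} = (\<xi> + t) / (2 * \<xi>)"
    unfolding d(2)
  proof (rule measure_uniform_interval_halfline)
    show "\<bar>t\<bar> < e0 * \<bar>d\<bar>"
      using assms(4) d(2) by (simp add: t_def)
  qed (use assms(2) d(1) in auto)
  also have "p i * ((\<xi> + t) / (2 * \<xi>)) = (3 * \<xi> + advantage Q Q0 \<alpha> i)\<^sup>2 / (18 * \<xi>)"
    using assms d by (simp add: p_def t_def power2_eq_square field_simps)
  finally show ?thesis
    by (simp add: disclosure_payoff_def prices)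
qed

section \<open>Equal qualities and one-sided disclosure\<close>

lemma disclosure_payoff_equal_qualities:
  assumes "0 < e0" "\<bar>r\<bar> < 3 * e0" "\<alpha> i \<noteq> \<alpha> (other i)"
  shows "disclosure_payoff (\<lambda>_. Q0 - r) c Q0 e0 \<alpha> i =
    Some (\<bar>\<alpha> i - \<alpha> (other i)\<bar> * (3 * e0 - sgn (\<alpha> i - \<alpha> (other i)) * r)\<^sup>2 / (18 * e0) - c i * \<alpha> i)"
proof -
  define d where "d = \<alpha> i - \<alpha> (other i)"
  have adv: "advantage (\<lambda>_. Q0 - r) Q0 \<alpha> i = - \<bar>d\<bar> * (sgn d * r)"
    by (simp add: advantage_def d_def abs_if sgn_if algebra_simps)
  have d: "\<bar>d\<bar> > 0"
    using assms(3) by (simp add: d_def)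
  then have "\<bar>advantage (\<lambda>_. Q0 - r) Q0 \<alpha> i\<bar> < 3 * (e0 * \<bar>d\<bar>)"
    using assms(2) mult_strict_left_mono[OF assms(2) d]
    by (simp add: adv abs_mult abs_sgn_eq algebra_simps)
  then have "disclosure_payoff (\<lambda>_. Q0 - r) c Q0 e0 \<alpha> i =
      Some ((3 * (e0 * \<bar>d\<bar>) + - \<bar>d\<bar> * (sgn d * r))\<^sup>2 / (18 * (e0 * \<bar>d\<bar>)) - c i * \<alpha> i)"
    using disclosure_payoff_interior[of e0 \<alpha> i "\<lambda>_. Q0 - r" Q0 c] assms
    unfolding d_def[symmetric] adv by simp
  also have "3 * (e0 * \<bar>d\<bar>) + - \<bar>d\<bar> * (sgn d * r) = \<bar>d\<bar> * (3 * e0 - sgn d * r)"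
    by (simp add: algebra_simps)
  also have "(\<bar>d\<bar> * (3 * e0 - sgn d * r))\<^sup>2 / (18 * (e0 * \<bar>d\<bar>)) = \<bar>d\<bar> * (3 * e0 - sgn d * r)\<^sup>2 / (18 * e0)"
    using d by (simp add: power2_eq_square)
  finally show ?thesis
    unfolding d_def .
qed

lemma disclosure_payoff_eq_positive:
  assumes "\<alpha> i = \<alpha> (other i)" "\<alpha> i \<noteq> 0"
  shows "disclosure_payoff Q c Q0 e0 \<alpha> i = None"
  using assms by (cases i) (auto simp: disclosure_payoff_def stage_prices_def Let_def)

lemma disclosure_payoff_zero:
  assumes "\<alpha> i = 0" "\<alpha> (other i) = 0"
  shows "disclosure_payoff Q c Q0 e0 \<alpha> i = Some 0"
  using assms
  by (cases i) (auto simp: disclosure_payoff_def stage_prices_def expected_profit_def)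

text \<open>Against a silent rival, level \<open>a > 0\<close> earns seller \<open>i\<close> the
  amount \<open>a * (?K - c i)\<close>, which is largest at \<open>a = 1\<close> by the bound on
  \<open>c i\<close>. The rival's payoff falls with his own level, since he loses differentiation
  and pays the cost.\<close>

lemma one_sided_disclosure:
  fixes i :: seller and c :: "seller \<Rightarrow> real"
  defines "\<alpha> \<equiv> (\<lambda>j. if j = i then 1 else 0 :: real)"
  assumes e0: "0 < e0" and r: "\<bar>r\<bar> < 3 * e0" and c: "\<forall>j. 0 < c j"
    and ci: "c i < (3 * e0 - r)\<^sup>2 / (18 * e0)"
  shows one_sided_disclosure_equilibrium: "disclosure_equilibrium (\<lambda>_. Q0 - r) c Q0 e0 \<alpha>"
    and one_sided_disclosure_positive:
      "\<exists>v. disclosure_payoff (\<lambda>_. Q0 - r) c Q0 e0 \<alpha> j = Some v \<and> v > 0"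
proof -
  let ?u = "disclosure_payoff (\<lambda>_. Q0 - r) c Q0 e0"
  let ?K = "(3 * e0 - r)\<^sup>2 / (18 * e0)" and ?L = "(3 * e0 + r)\<^sup>2 / (18 * e0)"
  note payoff = disclosure_payoff_equal_qualities[OF e0 r]
  have L: "?L > 0"
    using e0 r by (intro divide_pos_pos zero_less_power) auto
  have at_i: "?u \<alpha> i = Some (?K - c i)"
    by (subst payoff) (auto simp: \<alpha>_def)
  have at_j: "?u \<alpha> (other i) = Some ?L"
    by (subst payoff) (auto simp: \<alpha>_def)
  have dev_i: "w \<le> ?K - c i" if "a \<in> {0..1}" "?u (\<alpha>(i := a)) i = Some w" for a w
  proof (cases "a = 0")
    case True
    \<comment> \<open>Both levels are now 0, where the formula for unequal levels does not apply but
      both prices are 0.\<close>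
    then have "?u (\<alpha>(i := a)) i = Some 0"
      by (intro disclosure_payoff_zero) (auto simp: \<alpha>_def)
    then show ?thesis
      using that ci by simp
  next
    case False
    then have a: "a > 0" "a \<le> 1"
      using that by auto
    have "?u (\<alpha>(i := a)) i = Some (a * (3 * e0 - r)\<^sup>2 / (18 * e0) - c i * a)"
      using a by (subst payoff) (auto simp: \<alpha>_def)
    then have "w = a * (?K - c i)"
      using that(2) by (simp add: algebra_simps)
    also have "\<dots> \<le> ?K - c i"
      using a ci by (intro mult_left_le_one_le) auto
    finally show ?thesis .
  qed
  have dev_j: "w \<le> ?L" if "b \<in> {0..1}" "?u (\<alpha>(other i := b)) (other i) = Some w" for b w
  proof (cases "b = 1")
    case True
    \<comment> \<open>Matching the level 1 leaves no pricing equilibrium, so this deviation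
      constrains nothing.\<close>
    then have "?u (\<alpha>(other i := b)) (other i) = None"
      by (intro disclosure_payoff_eq_positive) (auto simp: \<alpha>_def)
    then show ?thesis
      using that(2) by simp
  next
    case False
    then have b: "0 \<le> b" "b < 1"
      using that by auto
    have "?u (\<alpha>(other i := b)) (other i)
        = Some ((1 - b) * (3 * e0 + r)\<^sup>2 / (18 * e0) - c (other i) * b)"
      using b by (subst payoff) (auto simp: \<alpha>_def)
    then have "w = (1 - b) * ?L - c (other i) * b"
      using that(2) by simp
    also have "\<dots> \<le> (1 - b) * ?L"
      using b c by (simp add: less_imp_le)
    also have "\<dots> \<le> ?L"
      using b L by (intro mult_left_le_one_le) auto
    finally show ?thesis .
  qed
  show "disclosure_equilibrium (\<lambda>_. Q0 - r) c Q0 e0 \<alpha>"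
    unfolding disclosure_equilibrium_def all_seller_iff[of _ i] at_i at_j
    using dev_i dev_j by (auto simp: \<alpha>_def)
  have "\<forall>j. \<exists>v. ?u \<alpha> j = Some v \<and> v > 0"
    unfolding all_seller_iff[of _ i] at_i at_j using ci L by simp
  then show "\<exists>v. ?u \<alpha> j = Some v \<and> v > 0" ..
qed

section \<open>The three comparisons\<close>

theorem proposition3:
  shows
    "(\<forall>i. (\<forall>Q c Q0 \<alpha>. game_params Q c Q0 0 \<and> disclosure_equilibrium Q c Q0 0 \<alpha> \<and> Q i < Q0
            \<longrightarrow> \<not> discloses \<alpha> i)
        \<and> (\<exists>Q c Q0 e0 \<alpha>. game_params Q c Q0 e0 \<and> e0 > 0 \<and> disclosure_equilibrium Q c Q0 e0 \<alpha>
            \<and> Q i < Q0 \<and> discloses \<alpha> i))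
   \<and> (\<forall>i. (\<forall>Q c Q0 \<alpha>. game_params Q c Q0 0 \<and> disclosure_equilibrium Q c Q0 0 \<alpha> \<and> \<not> discloses \<alpha> i
            \<longrightarrow> disclosure_payoff Q c Q0 0 \<alpha> i = Some 0)
        \<and> (\<exists>Q c Q0 e0 \<alpha> v. game_params Q c Q0 e0 \<and> e0 > 0 \<and> disclosure_equilibrium Q c Q0 e0 \<alpha>
            \<and> \<not> discloses \<alpha> i \<and> disclosure_payoff Q c Q0 e0 \<alpha> i = Some v \<and> v > 0))
   \<and> ((\<forall>Q c Q0 \<alpha>. game_params Q c Q0 0 \<and> disclosure_equilibrium Q c Q0 0 \<alpha>
            \<longrightarrow> \<not> (\<forall>i. \<exists>v. disclosure_payoff Q c Q0 0 \<alpha> i = Some v \<and> v > 0))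
        \<and> (\<exists>Q c Q0 e0 \<alpha>. game_params Q c Q0 e0 \<and> e0 > 0 \<and> disclosure_equilibrium Q c Q0 e0 \<alpha>
            \<and> (\<forall>i. \<exists>v. disclosure_payoff Q c Q0 e0 \<alpha> i = Some v \<and> v > 0)))"
proof -
  \<comment> \<open>One parameter set serves all three existence claims: \<open>Q0 = 3\<close>,
    \<open>e0 = 1\<close>, \<open>r = 1\<close> and cost 1/9, below the bound (3 - 1)^2/18 = 2/9.
    The quality is written \<open>3 - 1\<close> to match the form \<open>Q0 - r\<close>.\<close>
  have params: "game_params (\<lambda>_. 3 - 1) (\<lambda>_. 1 / 9) 3 1"
    by (simp add: game_params_def)
  define \<alpha> where "\<alpha> = (\<lambda>i j :: seller. if j = i then 1 else 0 :: real)"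
  have eq: "disclosure_equilibrium (\<lambda>_. 3 - 1) (\<lambda>_. 1 / 9) 3 1 (\<alpha> i)"
    and pos: "\<exists>v. disclosure_payoff (\<lambda>_. 3 - 1) (\<lambda>_. 1 / 9) 3 1 (\<alpha> i) j = Some v \<and> v > 0" for i j
    unfolding \<alpha>_def
    by (rule one_sided_disclosure_equilibrium one_sided_disclosure_positive; simp)+
  have disc: "discloses (\<alpha> i) j \<longleftrightarrow> j = i" for i j
    by (simp add: discloses_def \<alpha>_def)
  have params_pos: "\<forall>j. c j > 0" if "game_params Q c Q0 0" for Q c Q0
    using that by (simp add: game_params_def)
  have below: "\<exists>Q c Q0 e0 \<alpha>. game_params Q c Q0 e0 \<and> e0 > 0 \<and> disclosure_equilibrium Q c Q0 e0 \<alpha>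
      \<and> Q i < Q0 \<and> discloses \<alpha> i" for i
    using params eq[of i] disc[of i i]
    by (intro exI[of _ "\<lambda>_. 3 - 1"] exI[of _ "\<lambda>_. 1 / 9"] exI[of _ 3] exI[of _ 1] exI[of _ "\<alpha> i"])
      simp
  \<comment> \<open>Here the rival of seller \<open>i\<close> is the one who discloses.\<close>
  have silent: "\<exists>Q c Q0 e0 \<alpha> v. game_params Q c Q0 e0 \<and> e0 > 0 \<and> disclosure_equilibrium Q c Q0 e0 \<alpha>
      \<and> \<not> discloses \<alpha> i \<and> disclosure_payoff Q c Q0 e0 \<alpha> i = Some v \<and> v > 0" for i
  proof -
    obtain v where "disclosure_payoff (\<lambda>_. 3 - 1) (\<lambda>_. 1 / 9) 3 1 (\<alpha> (other i)) i = Some v" "v > 0"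
      using pos by blast
    then show ?thesis
      using params eq[of "other i"] disc[of "other i" i]
      by (intro exI[of _ "\<lambda>_. 3 - 1"] exI[of _ "\<lambda>_. 1 / 9"] exI[of _ 3] exI[of _ 1]
          exI[of _ "\<alpha> (other i)"] exI[of _ v]) simp
  qed
  have both: "\<exists>Q c Q0 e0 \<alpha>. game_params Q c Q0 e0 \<and> e0 > 0 \<and> disclosure_equilibrium Q c Q0 e0 \<alpha>
      \<and> (\<forall>i. \<exists>v. disclosure_payoff Q c Q0 e0 \<alpha> i = Some v \<and> v > 0)"
    using params eq[of Seller1] pos[of Seller1]
    by (intro exI[of _ "\<lambda>_. 3 - 1"] exI[of _ "\<lambda>_. 1 / 9"] exI[of _ 3] exI[of _ 1]
        exI[of _ "\<alpha> Seller1"]) simp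
  have "game_params Q c Q0 0 \<and> disclosure_equilibrium Q c Q0 0 \<alpha> \<and> Q i < Q0
      \<longrightarrow> \<not> discloses \<alpha> i" for Q c Q0 \<alpha> i
    using below_average_not_discloses_no_bias params_pos by blast
  moreover have "game_params Q c Q0 0 \<and> disclosure_equilibrium Q c Q0 0 \<alpha> \<and> \<not> discloses \<alpha> i
      \<longrightarrow> disclosure_payoff Q c Q0 0 \<alpha> i = Some 0" for Q c Q0 \<alpha> i
    using nondisclosing_payoff_no_bias params_pos by blast
  moreover have "game_params Q c Q0 0 \<and> disclosure_equilibrium Q c Q0 0 \<alpha>
      \<longrightarrow> \<not> (\<forall>i. \<exists>v. disclosure_payoff Q c Q0 0 \<alpha> i = Some v \<and> v > 0)" for Q c Q0 \<alpha>
    using not_both_positive_no_bias[of c Q Q0 \<alpha>] params_pos[of Q c Q0] by satx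
  ultimately show ?thesis
    using below silent both by (intro conjI allI) assumption+
qed

end
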